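(* Let $\gamma:\mathbb{R}_+\to\mathbb{R}$ and let $Z_h=\gamma(L_h)\mathcal{W}_h$ be the finite element approximation defined in the context, where $\mathcal{W}_h$ is white noise on $V_h$. Then $Z_h$ can be decomposed as $$Z_h=\sum_{i=1}^n z_i\psi_i$$ for some multi-normally distributed weights $\bm z=(z_1,\dots,z_n)^T$ with mean $\bm 0$ and covariance matrix $$\bm\Sigma_{\bm z}=\bm C^{-1/2}\,\gamma^2(\bm S)\,\bm C^{-1/2},\qquad\text{where}\quad \gamma^2(\bm S):=\bm V\,\mathrm{diag}\big(\gamma(\lambda_{1,h})^2,\dots,\gamma(\lambda_{n,h})^2\big)\,\bm V^T .$$
   Context: Let $d\ge 1$ and let $\mathcal{D}$ be either a bounded (convex and polygonal) domain of $\mathbb{R}^d$ or a compact $d$-dimensional smooth Riemannian manifold. Let $H=L^2(\mathcal{D})$ be the separable Hilbert space of real square-integrable functions on $\mathcal{D}$, with inner product $(\cdot,\cdot)_H$. Let $L$ be a densely defined, self-adjoint, positive semi-definite linear differential operator of second order, defined in a domain $\mathscr{D}(L)\subset H$ with Dirichlet boundary conditions on $\mathcal{D}$. $L$ is diagonalizable on an orthonormal basis $\{e_j\}_{j\in\mathbb{N}}$ of $H$, with eigenvalues $0\le\lambda_1\le\lambda_2\le\dots$ tending to $+\infty$. Let $\mathcal{T}_h$ be a triangulation of $\mathcal{D}$ with mesh size $h$ and let $\Psi=\{\psi_k\}_{1\le k\le n}$ be a family of linearly independent basis functions associated with $\mathcal{T}_h$ such that $\Psi\subset H$. Let $V_h\subset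 H$ be the linear span of $\Psi$, which is $n$-dimensional, and let $\{f_{j,h}\}_{1\le j\le n}$ be an orthonormal basis of $V_h$ for $(\cdot,\cdot)_H$. The discretization of $L$ on $V_h$ is $L_h:V_h\to V_h$, $L_h\psi=\sum_{j=1}^n(L\psi,f_{j,h})_Hf_{j,h}$. Let $\bm C=[(\psi_i,\psi_j)_H]_{1\le i,j\le n}$ (mass matrix, symmetric positive definite) and $\bm G=[(L\psi_i,\psi_j)_H]_{1\le i,j\le n}$ (stiffness matrix, symmetric positive semi-definite). Let $\bm C^{1/2}$ be the symmetric positive definite square root of $\bm C$, $\bm C^{-1/2}$ its inverse, and $\bm S=\bm C^{-1/2}\bm G\bm C^{-1/2}$. Let $\bm V=(\bm v_1|\dots|\bm v_n)$ be an orthonormal eigenbasis of $\bm S$, with associated eigenvalues $\lambda_{1,h},\dots,\lambda_{n,h}\in\mathbb{R}_+$, so that $\bm S=\bm V\,\mathrm{diag}(\lambda_{1,h},\dots,\lambda_{n,h})\,\bm V^T$. Let $E:\mathbb{R}^n\to V_h$, $E(\bm v)=\sum_{j=1}^n[\bm C^{-1/2}\bm v]_j\psi_j$, and $e_{j,h}=E(\bm v_j)$; the $e_{j,h}$ are orthonormal eigenfunctions of $L_h$ with eigenvalues $\lambda_{j,h}$. For $\gamma:\mathbb{R}_+\to\mathbb{R}$, the operator $\gamma(L_h):V_h\to V_h$ is defined by $\gamma(L_h)\psi=\sum_{j=1}^n\gamma(\lambda_{j,h})(\psi,e_{j,h})_He_{j,h}$. White noise on $V_h$ is the $V_h$-valued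 random variable $\mathcal{W}_h=\sum_{j=1}^n\tilde\xi_je_{j,h}$, where $\tilde\xi_1,\dots,\tilde\xi_n$ are independent standard normal random variables. The $V_h$-valued random variable $Z_h=\gamma(L_h)\mathcal{W}_h$ is called the finite element approximation of the generalized random field $Z=\gamma(L)\mathcal{W}=\sum_{j\in\mathbb{N}}\tilde\xi_j\gamma(\lambda_j)e_j$ (with $\{\tilde\xi_j\}_{j\in\mathbb{N}}$ independent standard normal variables), which is defined for $\gamma$ with $\sum_{j\in\mathbb{N}}\gamma(\lambda_j)^2<\infty$. *)

theory Defs
  imports "HOL-Probability.Probability"
begin

text \<open>
  The space \<open>L\<^sup>2(M)\<close> is a space of classes of functions modulo almost-everywhere equality, and it
  depends on a measure, so it is not itself a type. Instead, a Hilbert space type is declared to be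
  \<open>L\<^sup>2(M)\<close> by giving the map \<open>cls\<close> that sends a square-integrable function to its class.
\<close>

definition square_integrable :: "'d measure \<Rightarrow> ('d \<Rightarrow> real) \<Rightarrow> bool" where
  "square_integrable M f \<longleftrightarrow> f \<in> borel_measurable M \<and> integrable M (\<lambda>x. (f x)\<^sup>2)"

definition is_L2_space :: "'d measure \<Rightarrow> (('d \<Rightarrow> real) \<Rightarrow> 'h::{real_inner, polish_space}) \<Rightarrow> bool" where
  "is_L2_space M cls \<longleftrightarrow>
     (\<forall>f g. square_integrable M f \<longrightarrow> square_integrable M g \<longrightarrow>
        cls (\<lambda>x. f x + g x) = cls f + cls g \<and>
        cls f \<bullet> cls g = (LINT x|M. f x * g x)) \<and>
     (\<forall>c f. square_integrable M f \<longrightarrow> cls (\<lambda>x. c * f x) = c *\<^sub>R cls f) \<and>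
     cls ` {f. square_integrable M f} = UNIV"

definition orthonormal :: "('i \<Rightarrow> 'h::real_inner) \<Rightarrow> bool" where
  "orthonormal b \<longleftrightarrow> (\<forall>i j. b i \<bullet> b j = (if i = j then 1 else 0))"

definition orthonormal_basis :: "('i \<Rightarrow> 'h::real_inner) \<Rightarrow> bool" where
  "orthonormal_basis b \<longleftrightarrow> orthonormal b \<and> closure (span (range b)) = UNIV"

text \<open>
  A densely defined operator \<open>L\<close> with domain \<open>D\<close>; values of \<open>L\<close> outside \<open>D\<close> are irrelevant.
  Self-adjointness is equality of the graphs of the adjoint and of \<open>L\<close>, domains included.
\<close>

definition linear_operator_on :: "'h set \<Rightarrow> ('h::real_inner \<Rightarrow> 'h) \<Rightarrow> bool" where
  "linear_operator_on D L \<longleftrightarrow> subspace D \<and>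
     (\<forall>u\<in>D. \<forall>v\<in>D. L (u + v) = L u + L v) \<and> (\<forall>c. \<forall>u\<in>D. L (c *\<^sub>R u) = c *\<^sub>R L u)"

definition self_adjoint_on :: "'h set \<Rightarrow> ('h::real_inner \<Rightarrow> 'h) \<Rightarrow> bool" where
  "self_adjoint_on D L \<longleftrightarrow> {(v, w). \<forall>u\<in>D. L u \<bullet> v = u \<bullet> w} = {(v, L v) | v. v \<in> D}"

definition diagonalizable_psd_operator ::
    "'h set \<Rightarrow> ('h::real_inner \<Rightarrow> 'h) \<Rightarrow> (nat \<Rightarrow> real) \<Rightarrow> (nat \<Rightarrow> 'h) \<Rightarrow> bool" where
  "diagonalizable_psd_operator D L lam e \<longleftrightarrow>
     linear_operator_on D L \<and> closure D = UNIV \<and> self_adjoint_on D L \<and>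
     (\<forall>u\<in>D. L u \<bullet> u \<ge> 0) \<and>
     orthonormal_basis e \<and> (\<forall>j. e j \<in> D \<and> L (e j) = lam j *\<^sub>R e j) \<and>
     0 \<le> lam 0 \<and> incseq lam \<and> filterlim lam at_top sequentially"

text \<open>
  Finite element functions need not belong to the domain of \<open>L\<close> (continuous piecewise linear
  functions, for instance, are not in \<open>H\<^sup>2\<close>), so \<open>(L u, v)\<close> is read, as always in the finite element
  method, as the energy form of \<open>L\<close>, that is \<open>(L\<^sup>1\<^sup>/\<^sup>2 u, L\<^sup>1\<^sup>/\<^sup>2 v)\<close>, on the domain of
  \<open>L\<^sup>1\<^sup>/\<^sup>2\<close>. The lemmas \<open>domain_subset_energy_space\<close> and \<open>energy_form_eq\<close> below show that this is the
  literal inner product \<open>(L u, v)\<close> whenever \<open>u\<close> is in the domain of \<open>L\<close>.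
\<close>

definition energy_space :: "(nat \<Rightarrow> real) \<Rightarrow> (nat \<Rightarrow> 'h::real_inner) \<Rightarrow> 'h set" where
  "energy_space lam e = {u. summable (\<lambda>j. lam j * (u \<bullet> e j)\<^sup>2)}"

definition energy_form :: "(nat \<Rightarrow> real) \<Rightarrow> (nat \<Rightarrow> 'h::real_inner) \<Rightarrow> 'h \<Rightarrow> 'h \<Rightarrow> real" where
  "energy_form lam e u v = (\<Sum>j. lam j * (u \<bullet> e j) * (v \<bullet> e j))"

definition discretized_operator ::
    "(nat \<Rightarrow> real) \<Rightarrow> (nat \<Rightarrow> 'h::real_inner) \<Rightarrow> ('n::finite \<Rightarrow> 'h) \<Rightarrow> 'h \<Rightarrow> 'h" where
  "discretized_operator lam e f u = (\<Sum>j\<in>UNIV. energy_form lam e u (f j) *\<^sub>R f j)"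

definition mass_matrix :: "('n::finite \<Rightarrow> 'h::real_inner) \<Rightarrow> real^'n^'n" where
  "mass_matrix \<psi> = (\<chi> i j. \<psi> i \<bullet> \<psi> j)"

definition stiffness_matrix ::
    "(nat \<Rightarrow> real) \<Rightarrow> (nat \<Rightarrow> 'h::real_inner) \<Rightarrow> ('n::finite \<Rightarrow> 'h) \<Rightarrow> real^'n^'n" where
  "stiffness_matrix lam e \<psi> = (\<chi> i j. energy_form lam e (\<psi> i) (\<psi> j))"

definition is_spd_sqrt :: "real^'n::finite^'n \<Rightarrow> real^'n^'n \<Rightarrow> bool" where
  "is_spd_sqrt R A \<longleftrightarrow> transpose R = R \<and> (\<forall>x. x \<noteq> 0 \<longrightarrow> x \<bullet> (R *v x) > 0) \<and> R ** R = A"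

definition diag_matrix :: "('n::finite \<Rightarrow> real) \<Rightarrow> real^'n^'n" where
  "diag_matrix d = (\<chi> i j. if i = j then d i else 0)"

definition scaled_stiffness :: "real^'n::finite^'n \<Rightarrow> real^'n^'n \<Rightarrow> real^'n^'n" where
  "scaled_stiffness Ch G = matrix_inv Ch ** G ** matrix_inv Ch"

definition fem_map ::
    "real^'n::finite^'n \<Rightarrow> ('n \<Rightarrow> 'h::real_inner) \<Rightarrow> real^'n \<Rightarrow> 'h" where
  "fem_map Ch \<psi> v = (\<Sum>j\<in>UNIV. (matrix_inv Ch *v v) $ j *\<^sub>R \<psi> j)"

definition fem_eigenfunction ::
    "real^'n::finite^'n \<Rightarrow> ('n \<Rightarrow> 'h::real_inner) \<Rightarrow> real^'n^'n \<Rightarrow> 'n \<Rightarrow> 'h" where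
  "fem_eigenfunction Ch \<psi> V j = fem_map Ch \<psi> (column j V)"

text \<open>
  The operator \<open>\<gamma>(L\<^sub>h)\<close>, given by the eigenvalues \<open>lamh\<close> and an orthonormal eigenbasis \<open>eh\<close> of
  \<open>L\<^sub>h\<close>. The lemmas \<open>fem_eigenfunction_orthonormal\<close>, \<open>fem_eigenfunction_eigen\<close> and
  \<open>fem_eigenvalue_nonneg\<close> below show that these data really belong to the operator
  \<open>discretized_operator\<close>, and that \<open>\<gamma>\<close> is only evaluated on \<open>[0, \<infinity>)\<close>.
\<close>

definition spectral_function ::
    "(real \<Rightarrow> real) \<Rightarrow> ('n::finite \<Rightarrow> real) \<Rightarrow> ('n \<Rightarrow> 'h::real_inner) \<Rightarrow> 'h \<Rightarrow> 'h" where
  "spectral_function \<gamma> lamh eh u = (\<Sum>j\<in>UNIV. (\<gamma> (lamh j) * (u \<bullet> eh j)) *\<^sub>R eh j)"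

definition white_noise :: "('n::finite \<Rightarrow> 'w \<Rightarrow> real) \<Rightarrow> ('n \<Rightarrow> 'h::real_inner) \<Rightarrow> 'w \<Rightarrow> 'h" where
  "white_noise \<xi> eh \<omega> = (\<Sum>j\<in>UNIV. \<xi> j \<omega> *\<^sub>R eh j)"

definition independent_std_normals :: "'w measure \<Rightarrow> ('n::finite \<Rightarrow> 'w \<Rightarrow> real) \<Rightarrow> bool" where
  "independent_std_normals P \<xi> \<longleftrightarrow>
     prob_space.indep_vars P (\<lambda>_. borel) \<xi> UNIV \<and>
     (\<forall>j. distributed P lborel (\<xi> j) std_normal_density)"

text \<open>
  Normal laws with variance \<open>0\<close> are point masses; they must be admitted because \<open>\<gamma>\<close> may vanish at
  some eigenvalues, in which case the covariance matrix is singular.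
\<close>

definition normal_law :: "real \<Rightarrow> real \<Rightarrow> real measure" where
  "normal_law m \<sigma> = (if \<sigma> = 0 then return borel m else density lborel (normal_density m \<sigma>))"

definition multi_normal ::
    "'w measure \<Rightarrow> ('w \<Rightarrow> real^'n::finite) \<Rightarrow> real^'n \<Rightarrow> real^'n^'n \<Rightarrow> bool" where
  "multi_normal P z \<mu> \<Sigma> \<longleftrightarrow>
     z \<in> borel_measurable P \<and>
     (\<forall>a. \<exists>m \<sigma>. \<sigma> \<ge> 0 \<and> distr P borel (\<lambda>\<omega>. a \<bullet> z \<omega>) = normal_law m \<sigma>) \<and>
     (\<forall>i. integrable P (\<lambda>\<omega>. z \<omega> $ i) \<and> (LINT \<omega>|P. z \<omega> $ i) = \<mu> $ i) \<and>
     (\<forall>i j. integrable P (\<lambda>\<omega>. (z \<omega> $ i - \<mu> $ i) * (z \<omega> $ j - \<mu> $ j)) \<and>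
        (LINT \<omega>|P. (z \<omega> $ i - \<mu> $ i) * (z \<omega> $ j - \<mu> $ j)) = \<Sigma> $ i $ j)"


subsection \<open>The energy form extends \<open>(L u, v)\<close>\<close>

lemma orthonormal_basis_sums:
  fixes e :: "nat \<Rightarrow> 'h::real_inner"
  assumes "orthonormal_basis e"
  shows "(\<lambda>j. (x \<bullet> e j) *\<^sub>R e j) sums x"
proof -
  have on: "e i \<bullet> e j = (if i = j then 1 else 0)" for i j
    using assms by (simp add: orthonormal_basis_def orthonormal_def)
  define p where "p N = (\<Sum>j<N. (x \<bullet> e j) *\<^sub>R e j)" for N
  have p_e: "p N \<bullet> e i = x \<bullet> e i" if "i < N" for N i
  proof -
    have "p N \<bullet> e i = (\<Sum>j<N. if j = i then x \<bullet> e i else 0)"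
      unfolding p_def inner_sum_left by (rule sum.cong) (auto simp: on)
    with that show ?thesis by simp
  qed
  have best: "norm (x - p N) \<le> norm (x - y)" if "y \<in> span (e ` {..<N})" for y N
  proof -
    have "p N \<in> span (e ` {..<N})"
      unfolding p_def by (intro span_sum span_scale span_base) auto
    hence "p N - y \<in> span (e ` {..<N})" using that by (rule span_diff)
    moreover have "orthogonal (x - p N) w" if "w \<in> e ` {..<N}" for w
      using that p_e by (auto simp: orthogonal_def inner_diff_left)
    ultimately have "orthogonal (x - p N) (p N - y)"
      using orthogonal_to_span by blast
    hence "(x - p N) \<bullet> (p N - y) = 0" by (simp add: orthogonal_def)
    hence "(norm (x - y))\<^sup>2 = (norm (x - p N))\<^sup>2 + (norm (p N - y))\<^sup>2"
      using norm_add_Pythagorean[of "x - p N" "p N - y"] by (simp add: orthogonal_def)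
    thus ?thesis by (simp add: power2_le_imp_le)
  qed
  have "p \<longlonglongrightarrow> x"
  proof (rule LIMSEQ_I)
    fix r :: real assume "r > 0"
    have "x \<in> closure (span (range e))" using assms by (simp add: orthonormal_basis_def)
    then obtain y where y: "y \<in> span (range e)" "dist y x < r"
      using \<open>r > 0\<close> closure_approachable by blast
    obtain T where T: "finite T" "T \<subseteq> range e" "y \<in> span T"
    proof -
      obtain T r where "finite T" "T \<subseteq> range e" "y = (\<Sum>a\<in>T. r a *\<^sub>R a)"
        using y(1) unfolding span_explicit by auto
      moreover from this have "y \<in> span T" by (auto intro: span_sum span_scale span_base)
      ultimately show thesis using that by simp
    qed
    then obtain I where I: "finite I" "T = e ` I" by (meson finite_subset_image)
    obtain N where N: "I \<subseteq> {..<N}" using I(1) finite_nat_iff_bounded by blast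
    have "norm (p k - x) < r" if "k \<ge> N" for k
    proof -
      have "T \<subseteq> e ` {..<k}" using I N that by auto
      hence "y \<in> span (e ` {..<k})" using T(3) span_mono by blast
      from best[OF this] y(2) show ?thesis by (simp add: dist_norm norm_minus_commute)
    qed
    thus "\<exists>N. \<forall>k\<ge>N. norm (p k - x) < r" by blast
  qed
  thus ?thesis unfolding sums_def p_def[abs_def] .
qed

lemma diagonalizable_psd_operator_sums:
  assumes "diagonalizable_psd_operator D L lam e" and "u \<in> D"
  shows "(\<lambda>j. lam j * (u \<bullet> e j) * (v \<bullet> e j)) sums (L u \<bullet> v)"
proof -
  have eD: "e j \<in> D" and Le: "L (e j) = lam j *\<^sub>R e j" for j
    using assms(1) by (auto simp: diagonalizable_psd_operator_def)
  have "(u, L u) \<in> {(v, w). \<forall>u\<in>D. L u \<bullet> v = u \<bullet> w}"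
    using assms by (auto simp: diagonalizable_psd_operator_def self_adjoint_on_def)
  hence "L (e j) \<bullet> u = e j \<bullet> L u" for j using eD by blast
  hence coeff: "L u \<bullet> e j = lam j * (u \<bullet> e j)" for j
    by (simp add: Le inner_commute)
  have "(\<lambda>j. (v \<bullet> e j) *\<^sub>R e j) sums v"
    using assms(1) by (auto simp: diagonalizable_psd_operator_def intro: orthonormal_basis_sums)
  hence "(\<lambda>j. L u \<bullet> ((v \<bullet> e j) *\<^sub>R e j)) sums (L u \<bullet> v)"
    by (rule bounded_linear.sums[OF bounded_linear_inner_right])
  thus ?thesis by (simp add: coeff mult_ac)
qed

lemma domain_subset_energy_space:
  assumes "diagonalizable_psd_operator D L lam e"
  shows "D \<subseteq> energy_space lam e"
  using diagonalizable_psd_operator_sums[OF assms, THEN sums_summable]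
  by (auto simp: energy_space_def power2_eq_square mult.assoc)

lemma energy_form_eq:
  assumes "diagonalizable_psd_operator D L lam e" and "u \<in> D"
  shows "energy_form lam e u v = L u \<bullet> v"
  using diagonalizable_psd_operator_sums[OF assms] by (simp add: energy_form_def sums_iff)


subsection \<open>The eigenpairs of the discretized operator\<close>

lemma energy_form_commute: "energy_form lam e u v = energy_form lam e v u"
  by (simp add: energy_form_def mult_ac)

lemma energy_form_summable:
  fixes lam :: "nat \<Rightarrow> real"
  assumes "\<And>j. lam j \<ge> 0" "u \<in> energy_space lam e" "v \<in> energy_space lam e"
  shows "summable (\<lambda>j. lam j * (u \<bullet> e j) * (v \<bullet> e j))"
proof (rule summable_comparison_test')
  show "summable (\<lambda>j. lam j * (u \<bullet> e j)\<^sup>2 + lam j * (v \<bullet> e j)\<^sup>2)"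
    using assms by (auto simp: energy_space_def intro: summable_add)
  have "\<bar>x * y\<bar> \<le> x\<^sup>2 + y\<^sup>2" for x y :: real
  proof -
    have "0 \<le> (\<bar>x\<bar> - \<bar>y\<bar>)\<^sup>2" "0 \<le> \<bar>x\<bar> * \<bar>y\<bar>" by auto
    thus ?thesis unfolding power2_diff abs_mult power2_abs by linarith
  qed
  hence "lam j * \<bar>(u \<bullet> e j) * (v \<bullet> e j)\<bar> \<le> lam j * ((u \<bullet> e j)\<^sup>2 + (v \<bullet> e j)\<^sup>2)" for j
    using assms(1) by (intro mult_left_mono) auto
  thus "norm (lam j * (u \<bullet> e j) * (v \<bullet> e j)) \<le> lam j * (u \<bullet> e j)\<^sup>2 + lam j * (v \<bullet> e j)\<^sup>2" for j
    using assms(1)[of j] by (simp add: abs_mult algebra_simps)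
qed

lemma energy_space_subspace:
  fixes lam :: "nat \<Rightarrow> real"
  assumes "\<And>j. lam j \<ge> 0"
  shows "subspace (energy_space lam e)"
proof (rule subspaceI)
  show "0 \<in> energy_space lam e" by (simp add: energy_space_def)
  fix u v assume uv: "u \<in> energy_space lam e" "v \<in> energy_space lam e"
  have "summable (\<lambda>j. lam j * (u \<bullet> e j)\<^sup>2 + lam j * (v \<bullet> e j)\<^sup>2
          + 2 * (lam j * (u \<bullet> e j) * (v \<bullet> e j)))"
    using uv energy_form_summable[OF assms uv]
    by (intro summable_add summable_mult) (auto simp: energy_space_def)
  thus "u + v \<in> energy_space lam e"
    by (simp add: energy_space_def inner_add_left power2_sum algebra_simps)
next
  fix c u assume "u \<in> energy_space lam e"
  hence "summable (\<lambda>j. c\<^sup>2 * (lam j * (u \<bullet> e j)\<^sup>2))"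
    by (intro summable_mult) (simp add: energy_space_def)
  thus "c *\<^sub>R u \<in> energy_space lam e"
    by (simp add: energy_space_def power_mult_distrib mult_ac)
qed

lemma energy_form_add_left:
  fixes lam :: "nat \<Rightarrow> real"
  assumes "\<And>j. lam j \<ge> 0"
    and "u \<in> energy_space lam e" "v \<in> energy_space lam e" "w \<in> energy_space lam e"
  shows "energy_form lam e (u + v) w = energy_form lam e u w + energy_form lam e v w"
  using suminf_add[OF energy_form_summable[OF assms(1) assms(2,4)]
      energy_form_summable[OF assms(1) assms(3,4)]]
  by (simp add: energy_form_def inner_add_left algebra_simps)

lemma energy_form_scale_left:
  fixes lam :: "nat \<Rightarrow> real"
  assumes "\<And>j. lam j \<ge> 0" and "u \<in> energy_space lam e" "w \<in> energy_space lam e"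
  shows "energy_form lam e (c *\<^sub>R u) w = c * energy_form lam e u w"
  using suminf_mult[OF energy_form_summable[OF assms], of c]
  by (simp add: energy_form_def mult_ac)

lemma energy_form_sum_left:
  fixes lam :: "nat \<Rightarrow> real"
  assumes "\<And>j. lam j \<ge> 0" and "finite I"
    and "\<And>i. i \<in> I \<Longrightarrow> u i \<in> energy_space lam e" "w \<in> energy_space lam e"
  shows "energy_form lam e (\<Sum>i\<in>I. c i *\<^sub>R u i) w = (\<Sum>i\<in>I. c i * energy_form lam e (u i) w)"
  using assms(2,3)
proof (induction I rule: finite_induct)
  case empty
  show ?case by (simp add: energy_form_def)
next
  case (insert a I)
  have "(\<Sum>i\<in>I. c i *\<^sub>R u i) \<in> energy_space lam e"
    using insert by (intro subspace_sum subspace_scale energy_space_subspace assms(1)) auto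
  moreover have "c a *\<^sub>R u a \<in> energy_space lam e"
    using insert by (intro subspace_scale energy_space_subspace assms(1)) auto
  ultimately show ?case
    using insert assms by (simp add: energy_form_add_left energy_form_scale_left)
qed

lemma is_spd_sqrt_inverse:
  assumes "is_spd_sqrt R A"
  shows "matrix_inv R ** R = mat 1" "R ** matrix_inv R = mat 1"
    "transpose (matrix_inv R) = matrix_inv R"
proof -
  have "x = 0" if "R *v x = 0" for x
  proof (rule ccontr)
    assume "x \<noteq> 0"
    hence "x \<bullet> (R *v x) > 0" using assms by (auto simp: is_spd_sqrt_def)
    thus False by (simp add: that)
  qed
  then obtain B where "B ** R = mat 1" using matrix_left_invertible_ker[of R] by blast
  moreover from this have "R ** B = mat 1" by (simp add: matrix_left_right_inverse)
  ultimately have ex: "\<exists>B. R ** B = mat 1 \<and> B ** R = mat 1" by blast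
  show 1: "matrix_inv R ** R = mat 1" and 2: "R ** matrix_inv R = mat 1"
    using someI_ex[OF ex] by (auto simp: matrix_inv_def)
  have "R ** transpose (matrix_inv R) = mat 1"
    using arg_cong[OF 1, of transpose] assms
    by (simp add: matrix_transpose_mul is_spd_sqrt_def transpose_mat)
  hence "matrix_inv R ** (R ** transpose (matrix_inv R)) = matrix_inv R" by simp
  thus "transpose (matrix_inv R) = matrix_inv R" by (simp add: matrix_mul_assoc 1)
qed

locale fem_eigenpairs =
  fixes lam :: "nat \<Rightarrow> real" and e :: "nat \<Rightarrow> 'h::real_inner" and \<psi> :: "'n::finite \<Rightarrow> 'h"
    and Ch V :: "real^'n^'n" and lamh :: "'n \<Rightarrow> real"
  assumes lam_nonneg: "lam j \<ge> 0"
    and \<psi>_energy: "range \<psi> \<subseteq> energy_space lam e"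
    and Ch: "is_spd_sqrt Ch (mass_matrix \<psi>)"
    and V: "orthogonal_matrix V"
    and S: "scaled_stiffness Ch (stiffness_matrix lam e \<psi>) = V ** diag_matrix lamh ** transpose V"
begin

lemma fem_map_inner_basis: "fem_map Ch \<psi> v \<bullet> \<psi> i = (Ch *v v) $ i"
proof -
  have "fem_map Ch \<psi> v \<bullet> \<psi> i = (mass_matrix \<psi> *v (matrix_inv Ch *v v)) $ i"
    unfolding fem_map_def inner_sum_left matrix_vector_mult_def[of "mass_matrix \<psi>"]
    by (simp add: mass_matrix_def inner_commute mult.commute)
  also have "mass_matrix \<psi> *v (matrix_inv Ch *v v) = (Ch ** (Ch ** matrix_inv Ch)) *v v"
    using Ch by (simp add: is_spd_sqrt_def matrix_mul_assoc matrix_vector_mul_assoc)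
  finally show ?thesis by (simp add: is_spd_sqrt_inverse[OF Ch])
qed

lemma fem_map_inner: "fem_map Ch \<psi> v \<bullet> fem_map Ch \<psi> w = v \<bullet> w"
proof -
  have "fem_map Ch \<psi> v \<bullet> fem_map Ch \<psi> w = (Ch *v v) \<bullet> (matrix_inv Ch *v w)"
    by (subst (2) fem_map_def)
      (simp add: inner_sum_right fem_map_inner_basis inner_vec_def mult.commute)
  also have "\<dots> = v \<bullet> ((Ch ** matrix_inv Ch) *v w)"
    using Ch by (metis dot_lmul_matrix is_spd_sqrt_def matrix_vector_mul_assoc transpose_matrix_vector)
  finally show ?thesis by (simp add: is_spd_sqrt_inverse[OF Ch])
qed

lemma fem_eigenfunction_orthonormal: "orthonormal (fem_eigenfunction Ch \<psi> V)"
  using V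
  by (auto simp: orthonormal_def fem_eigenfunction_def fem_map_inner norm_eq_1
      orthogonal_matrix_orthonormal_columns orthogonal_def)

lemma scaled_stiffness_column:
  "scaled_stiffness Ch (stiffness_matrix lam e \<psi>) *v column j V = lamh j *\<^sub>R column j V"
proof -
  have "transpose V *v column j V = axis j 1"
    using V by (metis matrix_vector_mul_assoc matrix_vector_mul_lid matrix_vector_mult_basis
        orthogonal_matrix_def)
  moreover have "diag_matrix lamh *v axis j 1 = lamh j *\<^sub>R axis j 1"
    unfolding matrix_vector_mult_basis by (simp add: vec_eq_iff column_def diag_matrix_def axis_def)
  ultimately show ?thesis
    by (simp add: S flip: matrix_vector_mul_assoc)
       (simp add: matrix_vector_mult_scaleR matrix_vector_mult_basis)
qed

lemma fem_map_energy: "fem_map Ch \<psi> v \<in> energy_space lam e"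
  unfolding fem_map_def using \<psi>_energy
  by (intro subspace_sum subspace_scale energy_space_subspace lam_nonneg) auto

lemma energy_form_eigenfunction_basis:
  "energy_form lam e (fem_eigenfunction Ch \<psi> V j) (\<psi> i)
     = lamh j * (fem_eigenfunction Ch \<psi> V j \<bullet> \<psi> i)"
proof -
  let ?v = "column j V" and ?G = "stiffness_matrix lam e \<psi>"
  have "energy_form lam e (fem_map Ch \<psi> ?v) (\<psi> i) = (?G *v (matrix_inv Ch *v ?v)) $ i"
    unfolding fem_map_def matrix_vector_mult_def[of ?G]
    using \<psi>_energy lam_nonneg
    by (subst energy_form_sum_left)
      (auto simp: stiffness_matrix_def mult.commute
        intro!: sum.cong arg_cong2[of _ _ _ _ "(*)"] energy_form_commute)
  also have "?G *v (matrix_inv Ch *v ?v)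
      = ((Ch ** matrix_inv Ch) ** ?G ** matrix_inv Ch) *v ?v"
    by (simp add: is_spd_sqrt_inverse[OF Ch] matrix_vector_mul_assoc)
  also have "\<dots> = Ch *v (scaled_stiffness Ch ?G *v ?v)"
    by (simp add: scaled_stiffness_def matrix_vector_mul_assoc matrix_mul_assoc)
  also have "\<dots> = lamh j *\<^sub>R (Ch *v ?v)"
    by (simp add: scaled_stiffness_column matrix_vector_mult_scaleR)
  finally show ?thesis by (simp add: fem_eigenfunction_def fem_map_inner_basis)
qed

lemma energy_form_eigenfunction:
  assumes "w \<in> span (range \<psi>)"
  shows "energy_form lam e (fem_eigenfunction Ch \<psi> V j) w
     = lamh j * (fem_eigenfunction Ch \<psi> V j \<bullet> w)"
proof -
  let ?u = "fem_eigenfunction Ch \<psi> V j"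
  have u: "?u \<in> energy_space lam e" by (simp add: fem_eigenfunction_def fem_map_energy)
  have sub: "subspace (energy_space lam e)" by (rule energy_space_subspace[OF lam_nonneg])
  have "subspace {w \<in> energy_space lam e. energy_form lam e w ?u = lamh j * (?u \<bullet> w)}"
    using u sub lam_nonneg
    by (intro subspaceI)
      (auto simp: subspace_0 subspace_add subspace_scale energy_form_add_left
        energy_form_scale_left inner_add_right algebra_simps, simp add: energy_form_def)
  moreover have "range \<psi> \<subseteq> {w \<in> energy_space lam e. energy_form lam e w ?u = lamh j * (?u \<bullet> w)}"
    using \<psi>_energy energy_form_eigenfunction_basis
    by (auto simp: energy_form_commute[of lam e "\<psi> _" ?u])
  ultimately have "w \<in> {w \<in> energy_space lam e. energy_form lam e w ?u = lamh j * (?u \<bullet> w)}"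
    using assms span_minimal by blast
  thus ?thesis by (simp add: energy_form_commute[of lam e ?u w])
qed

lemma fem_eigenfunction_eigen:
  fixes f :: "'n \<Rightarrow> 'h"
  assumes "orthonormal f" and "span (range f) = span (range \<psi>)"
  shows "discretized_operator lam e f (fem_eigenfunction Ch \<psi> V j)
    = lamh j *\<^sub>R fem_eigenfunction Ch \<psi> V j"
proof -
  let ?u = "fem_eigenfunction Ch \<psi> V j"
  have on: "f i \<bullet> f k = (if i = k then 1 else 0)" for i k
    using assms(1) by (simp add: orthonormal_def)
  have "?u \<in> span (range f)"
    unfolding assms(2) fem_eigenfunction_def fem_map_def
    by (intro span_sum span_scale span_base) auto
  moreover have "span (range f) \<subseteq> {u. u = (\<Sum>k\<in>UNIV. (u \<bullet> f k) *\<^sub>R f k)}"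
  proof (rule span_minimal)
    show "range f \<subseteq> {u. u = (\<Sum>k\<in>UNIV. (u \<bullet> f k) *\<^sub>R f k)}"
      by (auto simp: on if_distrib[of "\<lambda>c. c *\<^sub>R _"] cong: if_cong)
    show "subspace {u. u = (\<Sum>k\<in>UNIV. (u \<bullet> f k) *\<^sub>R f k)}"
      by (rule subspaceI)
        (auto simp: inner_add_left scaleR_left.add sum.distrib simp flip: scaleR_scaleR scaleR_sum_right)
  qed
  ultimately have expand: "?u = (\<Sum>k\<in>UNIV. (?u \<bullet> f k) *\<^sub>R f k)" by blast
  have "f k \<in> span (range \<psi>)" for k
    using span_base[of "f k" "range f"] by (simp add: assms(2))
  hence "discretized_operator lam e f ?u = lamh j *\<^sub>R (\<Sum>k\<in>UNIV. (?u \<bullet> f k) *\<^sub>R f k)"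
    by (simp add: discretized_operator_def energy_form_eigenfunction scaleR_sum_right)
  thus ?thesis unfolding expand[symmetric] .
qed

lemma fem_eigenvalue_nonneg: "lamh j \<ge> 0"
proof -
  let ?u = "fem_eigenfunction Ch \<psi> V j"
  have u: "?u \<in> energy_space lam e" by (simp add: fem_eigenfunction_def fem_map_energy)
  have "?u \<in> span (range \<psi>)"
    unfolding fem_eigenfunction_def fem_map_def by (intro span_sum span_scale span_base) auto
  hence "energy_form lam e ?u ?u = lamh j"
    using fem_eigenfunction_orthonormal
    by (simp add: energy_form_eigenfunction orthonormal_def)
  moreover have "energy_form lam e ?u ?u \<ge> 0"
    unfolding energy_form_def
    by (intro suminf_nonneg energy_form_summable u lam_nonneg) (simp add: lam_nonneg mult.assoc)
  ultimately show ?thesis by simp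
qed

end

end

theory Submission
  imports Defs
begin

text \<open>
  In the orthonormal eigenbasis \<open>e\<^sub>j\<^sub>,\<^sub>h\<close> of \<open>L\<^sub>h\<close>, the field \<open>\<gamma>(L\<^sub>h) W\<^sub>h\<close> has the coordinates
  \<open>\<gamma>(\<lambda>\<^sub>j\<^sub>,\<^sub>h) \<xi>\<^sub>j\<close> (\<open>spectral_function_white_noise\<close>). The eigenbasis is the image of the columns
  of \<open>V\<close> under the linear map \<open>E\<close> (\<open>fem_map\<close>), and \<open>E v\<close> has coordinates \<open>C\<^sup>-\<^sup>1\<^sup>/\<^sup>2 v\<close> in the finite
  element basis. The weights are therefore \<open>z = B \<xi>\<close> with the deterministic matrix
  \<open>B = C\<^sup>-\<^sup>1\<^sup>/\<^sup>2 V diag(\<gamma>(\<lambda>\<^sub>1\<^sub>,\<^sub>h), \<dots>, \<gamma>(\<lambda>\<^sub>n\<^sub>,\<^sub>h))\<close> (\<open>fem_spectral_white_noise_expansion\<close>).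

  A linear image \<open>B \<xi>\<close> of a vector of independent standard normal variables is centred multinormal
  with covariance matrix \<open>B B\<^sup>T\<close> (\<open>multi_normal_linear_image\<close>): a linear form of \<open>B \<xi>\<close> is a linear
  form of \<open>\<xi>\<close>, hence normal by stability of the normal laws under convolution, and the first two
  moments of \<open>B \<xi>\<close> are read off from \<open>E \<xi>\<^sub>i = 0\<close> and \<open>E \<xi>\<^sub>i \<xi>\<^sub>j = \<delta>\<^sub>i\<^sub>j\<close>. Since \<open>C\<^sup>-\<^sup>1\<^sup>/\<^sup>2\<close> is symmetric,
  \<open>B B\<^sup>T\<close> is the asserted covariance matrix.
\<close>

context prob_space
begin

lemma independent_std_normals_cross_moments:
  assumes "independent_std_normals M \<xi>"
  shows "integrable M (\<lambda>\<omega>. \<xi> i \<omega> * \<xi> j \<omega>)"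
    and "expectation (\<lambda>\<omega>. \<xi> i \<omega> * \<xi> j \<omega>) = (if i = j then 1 else 0)"
    and "integrable M (\<xi> i)" and "expectation (\<xi> i) = 0"
proof -
  have D: "distributed M lborel (\<xi> k) std_normal_density" for k
    using assms by (simp add: independent_std_normals_def)
  have int: "integrable M (\<xi> k)" for k
    using distributed_integrable[OF D, of "\<lambda>x. x" k] integrable_std_normal_moment[of 1] by simp
  have mean: "expectation (\<xi> k) = 0" for k
    by (rule standard_normal_distributed_expectation[OF D])
  show "integrable M (\<xi> i)" "expectation (\<xi> i) = 0"
    by (fact int, fact mean)
  show "integrable M (\<lambda>\<omega>. \<xi> i \<omega> * \<xi> j \<omega>)"
    and "expectation (\<lambda>\<omega>. \<xi> i \<omega> * \<xi> j \<omega>) = (if i = j then 1 else 0)"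
  proof (atomize (full), cases "i = j")
    case True
    have "integrable M (\<lambda>\<omega>. (\<xi> i \<omega>)\<^sup>2)"
      using distributed_integrable[OF D, of "\<lambda>x. x\<^sup>2" i] integrable_std_normal_moment[of 2] by simp
    with True show "integrable M (\<lambda>\<omega>. \<xi> i \<omega> * \<xi> j \<omega>)
        \<and> expectation (\<lambda>\<omega>. \<xi> i \<omega> * \<xi> j \<omega>) = (if i = j then 1 else 0)"
      using standard_normal_distributed_variance[OF D, of i] mean
      by (simp add: power2_eq_square)
  next
    case False
    have "indep_vars (\<lambda>_. borel) \<xi> {i, j}"
      using assms indep_vars_subset[of "\<lambda>_. borel" \<xi> UNIV "{i, j}"]
      by (simp add: independent_std_normals_def)
    from indep_vars_integrable[OF _ this] indep_vars_lebesgue_integral[OF _ this] False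
    show "integrable M (\<lambda>\<omega>. \<xi> i \<omega> * \<xi> j \<omega>)
        \<and> expectation (\<lambda>\<omega>. \<xi> i \<omega> * \<xi> j \<omega>) = (if i = j then 1 else 0)"
      by (simp add: int mean)
  qed
qed

text \<open>
  The sum of independent normal variables with positive variances is normal. Terms with coefficient
  \<open>0\<close> are point masses and have to be dropped beforehand; if no term remains, the law is the
  degenerate one, and both cases are covered by \<open>normal_law\<close>.
\<close>

lemma distr_linear_form_std_normals:
  fixes \<xi> :: "'n::finite \<Rightarrow> 'a \<Rightarrow> real" and c :: "real^'n"
  assumes "independent_std_normals M \<xi>"
  shows "distr M borel (\<lambda>\<omega>. c \<bullet> (\<chi> j. \<xi> j \<omega>)) = normal_law 0 (norm c)"
proof (cases "c = 0")
  case True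
  thus ?thesis by (simp add: normal_law_def distr_const)
next
  case False
  let ?J = "{j. c $ j \<noteq> 0}"
  have "indep_vars (\<lambda>_. borel) \<xi> ?J"
    using assms indep_vars_subset[of "\<lambda>_. borel" \<xi> UNIV ?J]
    by (simp add: independent_std_normals_def)
  hence indep: "indep_vars (\<lambda>_. borel) (\<lambda>j \<omega>. c $ j * \<xi> j \<omega>) ?J"
    by (rule indep_vars_compose2[where Y = "\<lambda>j x. c $ j * x"]) simp
  have "distributed M lborel (\<lambda>\<omega>. c $ j * \<xi> j \<omega>) (normal_density 0 \<bar>c $ j\<bar>)" if "j \<in> ?J" for j
    using normal_density_affine[of "\<xi> j" 0 1 "c $ j" 0] that assms
    by (simp add: independent_std_normals_def)
  with indep False have "distributed M lborel (\<lambda>\<omega>. \<Sum>j\<in>?J. c $ j * \<xi> j \<omega>)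
      (normal_density (\<Sum>j\<in>?J. 0) (sqrt (\<Sum>j\<in>?J. \<bar>c $ j\<bar>\<^sup>2)))"
    by (intro sum_indep_normal) (auto simp: vec_eq_iff)
  also have "(\<lambda>\<omega>. \<Sum>j\<in>?J. c $ j * \<xi> j \<omega>) = (\<lambda>\<omega>. c \<bullet> (\<chi> j. \<xi> j \<omega>))"
    by (auto simp: inner_vec_def intro!: sum.mono_neutral_left)
  also have "(\<Sum>j\<in>?J. \<bar>c $ j\<bar>\<^sup>2) = (norm c)\<^sup>2"
  proof -
    have "(norm c)\<^sup>2 = (\<Sum>j\<in>UNIV. \<bar>c $ j\<bar>\<^sup>2)"
      by (simp only: norm_vec_def L2_set_def real_norm_def)
        (simp add: sum_nonneg)
    also have "\<dots> = (\<Sum>j\<in>?J. \<bar>c $ j\<bar>\<^sup>2)"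
      by (rule sum.mono_neutral_right) auto
    finally show ?thesis ..
  qed
  finally have "distr M lborel (\<lambda>\<omega>. c \<bullet> (\<chi> j. \<xi> j \<omega>)) = density lborel (normal_density 0 (norm c))"
    by (simp add: distributed_distr_eq_density)
  moreover have "distr M lborel X = distr M borel X" for X :: "'a \<Rightarrow> real"
    by (rule distr_cong) auto
  ultimately show ?thesis using False by (simp add: normal_law_def)
qed

text \<open>
  A linear form \<open>a \<bullet> B \<xi>\<close> equals \<open>B\<^sup>T a \<bullet> \<xi>\<close>, and the covariances follow by bilinearity.
\<close>

lemma multi_normal_linear_image:
  fixes \<xi> :: "'n::finite \<Rightarrow> 'a \<Rightarrow> real" and B :: "real^'n^'m::finite"
  assumes "independent_std_normals M \<xi>"
  shows "multi_normal M (\<lambda>\<omega>. B *v (\<chi> j. \<xi> j \<omega>)) 0 (B ** transpose B)"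
proof -
  note mom = independent_std_normals_cross_moments[OF assms]
  note [simp] = mom
  have coord: "(B *v (\<chi> j. \<xi> j \<omega>)) $ i = (\<Sum>k\<in>UNIV. B $ i $ k * \<xi> k \<omega>)" for i \<omega>
    by (simp add: matrix_vector_mult_def)
  have [measurable]: "\<xi> k \<in> borel_measurable M" for k
    using mom(3) by (rule borel_measurable_integrable)
  have "(\<lambda>\<omega>. B *v (\<chi> j. \<xi> j \<omega>)) \<in> borel_measurable M"
  proof (subst borel_measurable_euclidean_space, rule ballI)
    fix b :: "real^'m" assume "b \<in> Basis"
    then obtain i where "b = axis i 1" by (auto simp: Basis_vec_def)
    thus "(\<lambda>\<omega>. (B *v (\<chi> j. \<xi> j \<omega>)) \<bullet> b) \<in> borel_measurable M"
      by (simp add: inner_axis coord)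
  qed
  moreover have "distr M borel (\<lambda>\<omega>. a \<bullet> (B *v (\<chi> j. \<xi> j \<omega>))) = normal_law 0 (norm (transpose B *v a))"
    for a
    using distr_linear_form_std_normals[OF assms, of "transpose B *v a"]
    by (simp add: dot_lmul_matrix)
  moreover have "integrable M (\<lambda>\<omega>. (B *v (\<chi> j. \<xi> j \<omega>)) $ i)
      \<and> expectation (\<lambda>\<omega>. (B *v (\<chi> j. \<xi> j \<omega>)) $ i) = 0" for i
    by (simp add: coord)
  moreover have "integrable M (\<lambda>\<omega>. (B *v (\<chi> j. \<xi> j \<omega>)) $ i * (B *v (\<chi> j. \<xi> j \<omega>)) $ k)
      \<and> expectation (\<lambda>\<omega>. (B *v (\<chi> j. \<xi> j \<omega>)) $ i * (B *v (\<chi> j. \<xi> j \<omega>)) $ k)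
        = (B ** transpose B) $ i $ k" for i k
  proof -
    have prod: "(B *v (\<chi> j. \<xi> j \<omega>)) $ i * (B *v (\<chi> j. \<xi> j \<omega>)) $ k
        = (\<Sum>p\<in>UNIV. \<Sum>q\<in>UNIV. (B $ i $ p * B $ k $ q) * (\<xi> p \<omega> * \<xi> q \<omega>))" for \<omega>
      by (simp add: coord sum_product mult_ac)
    show ?thesis
      unfolding prod
      by (simp add: matrix_matrix_mult_def transpose_def if_distrib[of "(*) _"] cong: if_cong)
  qed
  ultimately show ?thesis
    unfolding multi_normal_def by (auto intro: norm_ge_zero)
qed

end

lemma spectral_function_white_noise:
  assumes "orthonormal eh"
  shows "spectral_function \<gamma> lamh eh (white_noise \<xi> eh \<omega>)
    = (\<Sum>j\<in>UNIV. (\<gamma> (lamh j) * \<xi> j \<omega>) *\<^sub>R eh j)"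
proof -
  have "white_noise \<xi> eh \<omega> \<bullet> eh j = \<xi> j \<omega>" for j
    using assms
    by (simp add: white_noise_def inner_sum_left orthonormal_def if_distrib[of "(*) _"] cong: if_cong)
  thus ?thesis by (simp add: spectral_function_def)
qed

lemma linear_fem_map: "linear (fem_map Ch \<psi>)"
  unfolding fem_map_def
  by (intro linearI)
    (simp_all add: matrix_vector_right_distrib matrix_vector_mult_scaleR scaleR_add_left
      sum.distrib scaleR_sum_right)

lemma matrix_mult_diag_matrix_vector:
  "(V ** diag_matrix d) *v x = (\<Sum>j\<in>UNIV. (d j * x $ j) *\<^sub>R column j V)"
  by (simp add: vec_eq_iff matrix_vector_mult_def matrix_matrix_mult_def diag_matrix_def column_def
      if_distrib[of "(*) _"] mult_ac cong: if_cong)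

lemma diag_matrix_mult_self:
  "diag_matrix d ** transpose (diag_matrix d) = diag_matrix (\<lambda>j. (d j)\<^sup>2)"
  by (simp add: vec_eq_iff matrix_matrix_mult_def transpose_def diag_matrix_def power2_eq_square
      if_distrib[of "(*) _"] cong: if_cong)

text \<open>
  \<open>V diag(\<gamma>(\<lambda>\<^sub>j\<^sub>,\<^sub>h)) \<xi>\<close> is the combination of the columns of \<open>V\<close> with the coefficients of the field in
  the eigenbasis, so by linearity \<open>E\<close> maps it to the field; \<open>C\<^sup>-\<^sup>1\<^sup>/\<^sup>2\<close> then converts to coordinates in
  the finite element basis.
\<close>

lemma (in fem_eigenpairs) fem_spectral_white_noise_expansion:
  "spectral_function \<gamma> lamh (fem_eigenfunction Ch \<psi> V) (white_noise \<xi> (fem_eigenfunction Ch \<psi> V) \<omega>)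
    = (\<Sum>i\<in>UNIV. ((matrix_inv Ch ** (V ** diag_matrix (\<lambda>j. \<gamma> (lamh j)))) *v (\<chi> j. \<xi> j \<omega>)) $ i *\<^sub>R \<psi> i)"
proof -
  have "spectral_function \<gamma> lamh (fem_eigenfunction Ch \<psi> V)
      (white_noise \<xi> (fem_eigenfunction Ch \<psi> V) \<omega>)
    = fem_map Ch \<psi> ((V ** diag_matrix (\<lambda>j. \<gamma> (lamh j))) *v (\<chi> j. \<xi> j \<omega>))"
    by (simp add: spectral_function_white_noise[OF fem_eigenfunction_orthonormal]
        matrix_mult_diag_matrix_vector linear_sum[OF linear_fem_map] linear_cmul[OF linear_fem_map]
        fem_eigenfunction_def)
  thus ?thesis
    by (simp add: fem_map_def matrix_vector_mul_assoc)
qed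

theorem theorem3p1:
  fixes M :: "'d measure" and cls :: "('d \<Rightarrow> real) \<Rightarrow> 'h::{real_inner, polish_space}"
    and D :: "'h set" and L :: "'h \<Rightarrow> 'h" and lam :: "nat \<Rightarrow> real" and e :: "nat \<Rightarrow> 'h"
    and \<psi> :: "'n::finite \<Rightarrow> 'h" and Ch V :: "real^'n^'n" and lamh :: "'n \<Rightarrow> real"
    and P :: "'w measure" and \<xi> :: "'n \<Rightarrow> 'w \<Rightarrow> real" and \<gamma> :: "real \<Rightarrow> real"
  assumes "finite_measure M" and "is_L2_space M cls"
    and "diagonalizable_psd_operator D L lam e"
    and "inj \<psi>" and "independent (range \<psi>)" and "range \<psi> \<subseteq> energy_space lam e"
    and "is_spd_sqrt Ch (mass_matrix \<psi>)"
    and "orthogonal_matrix V"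
    and "scaled_stiffness Ch (stiffness_matrix lam e \<psi>) = V ** diag_matrix lamh ** transpose V"
    and "prob_space P" and "independent_std_normals P \<xi>"
  shows "\<exists>z :: 'w \<Rightarrow> real^'n.
    (\<forall>\<omega>\<in>space P.
       spectral_function \<gamma> lamh (fem_eigenfunction Ch \<psi> V)
         (white_noise \<xi> (fem_eigenfunction Ch \<psi> V) \<omega>) = (\<Sum>i\<in>UNIV. z \<omega> $ i *\<^sub>R \<psi> i)) \<and>
    multi_normal P z 0
      (matrix_inv Ch ** (V ** diag_matrix (\<lambda>j. (\<gamma> (lamh j))\<^sup>2) ** transpose V) ** matrix_inv Ch)"
proof -
  interpret prob_space P by fact
  have "lam j \<ge> 0" for j
    using assms(3) incseqD[of lam 0 j] by (auto simp: diagonalizable_psd_operator_def)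
  then interpret fem_eigenpairs lam e \<psi> Ch V lamh
    using assms by unfold_locales auto
  let ?B = "matrix_inv Ch ** (V ** diag_matrix (\<lambda>j. \<gamma> (lamh j)))"
  have "?B ** transpose ?B = matrix_inv Ch ** (V ** (diag_matrix (\<lambda>j. \<gamma> (lamh j))
      ** transpose (diag_matrix (\<lambda>j. \<gamma> (lamh j)))) ** transpose V) ** matrix_inv Ch"
    by (simp add: matrix_transpose_mul is_spd_sqrt_inverse[OF Ch] matrix_mul_assoc)
  also have "\<dots> = matrix_inv Ch ** (V ** diag_matrix (\<lambda>j. (\<gamma> (lamh j))\<^sup>2) ** transpose V)
      ** matrix_inv Ch"
    by (simp only: diag_matrix_mult_self)
  finally have "multi_normal P (\<lambda>\<omega>. ?B *v (\<chi> j. \<xi> j \<omega>)) 0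
      (matrix_inv Ch ** (V ** diag_matrix (\<lambda>j. (\<gamma> (lamh j))\<^sup>2) ** transpose V) ** matrix_inv Ch)"
    using multi_normal_linear_image[OF assms(11), of ?B] by simp
  thus ?thesis
    by (intro exI[of _ "\<lambda>\<omega>. ?B *v (\<chi> j. \<xi> j \<omega>)"] conjI ballI fem_spectral_white_noise_expansion)
qed

end
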